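(* Let $G$ be a connected graph on $n$ vertices such that its eccentricity matrix $\mathcal{E}(G)$ is irreducible. Then the following statements are equivalent: (i) $G$ is $\mathcal{E}$-bipartite; (ii) the spectrum of $\mathcal{E}(G)$ is symmetric about the origin; (iii) $-\rho(\mathcal{E}(G))\in\sigma(\mathcal{E}(G))$; (iv) $\mathcal{E}^{\mathcal{L}}(G)$ and $\mathcal{E}^{\mathcal{Q}}(G)$ are similar matrices.
   Context: Graphs are finite, simple and undirected. For a connected graph $G$ with vertices $v_1,\dots,v_n$, $d(v_i,v_j)$ is the length of a shortest path and $e(v_i)=\max_j d(v_i,v_j)$ is the eccentricity. The eccentricity matrix $\mathcal{E}(G)$ is the symmetric $n\times n$ matrix with entries $\mathcal{E}_{ij}(G)=d(v_i,v_j)$ if $d(v_i,v_j)=\min\{e(v_i),e(v_j)\}$ and $\mathcal{E}_{ij}(G)=0$ if $d(v_i,v_j)<\min\{e(v_i),e(v_j)\}$. The $\mathcal{E}$-transmission of $v_i$ is $\mathrm{Tr}_{\mathcal{E}}(v_i)=\sum_j \mathcal{E}_{ij}(G)$, and $\mathrm{Diag}(\mathrm{Tr}_{\mathcal{E}}(G))$ is the diagonal matrix of these numbers. The eccentricity Laplacian is $\mathcal{E}^{\mathcal{L}}(G)=\mathrm{Diag}(\mathrm{Tr}_{\mathcal{E}}(G))-\mathcal{E}(G)$ and the eccentricity signless Laplacian is $\mathcal{E}^{\mathcal{Q}}(G)=\mathrm{Diag}(\mathrm{Tr}_{\mathcal{E}}(G))+\mathcal{E}(G)$. A connected graph $G$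 is $\mathcal{E}$-bipartite if, under a suitable labeling of the vertices, $\mathcal{E}(G)=\begin{bmatrix} O & B\\ B^T & O\end{bmatrix}$, where the diagonal blocks are square zero matrices. $\rho(A)$ is the spectral radius and $\sigma(A)$ the spectrum of $A$. The spectrum is symmetric about the origin if for every eigenvalue $\lambda$, $-\lambda$ is an eigenvalue with the same multiplicity. A matrix is reducible if it is permutationally similar to a block upper triangular matrix (with at least two square diagonal blocks), and irreducible otherwise. *)

theory Defs
  imports
    "Jordan_Normal_Form.Spectral_Radius"
    "Graph_Theory.Digraph_Component"
    "Graph_Theory.Pair_Digraph"
begin

text \<open>
  A finite simple undirected graph is a \<open>pair_graph\<close>: a finite, loop-free, symmetric digraph
  without parallel arcs, each undirected edge being the pair of arcs \<open>(u, v)\<close> and \<open>(v, u)\<close>.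
  The Graph-Theory predicate \<open>connected\<close> requires at least one vertex.
\<close>

definition graph_dist :: "'a pair_pre_digraph \<Rightarrow> 'a \<Rightarrow> 'a \<Rightarrow> nat" where
  "graph_dist G u v = (LEAST k. \<exists>p. pre_digraph.apath (with_proj G) u p v \<and> length p = k)"

definition eccentricity :: "'a pair_pre_digraph \<Rightarrow> 'a \<Rightarrow> nat" where
  "eccentricity G v = Max (graph_dist G v ` pverts G)"

definition vertex_labeling :: "'a pair_pre_digraph \<Rightarrow> 'a list \<Rightarrow> bool" where
  "vertex_labeling G vs \<longleftrightarrow> distinct vs \<and> set vs = pverts G"

definition ecc_mat :: "'a pair_pre_digraph \<Rightarrow> 'a list \<Rightarrow> real mat" where
  "ecc_mat G vs = mat (length vs) (length vs) (\<lambda>(i, j).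
     if graph_dist G (vs ! i) (vs ! j) = min (eccentricity G (vs ! i)) (eccentricity G (vs ! j))
     then real (graph_dist G (vs ! i) (vs ! j)) else 0)"

definition ecc_transmission :: "'a pair_pre_digraph \<Rightarrow> 'a list \<Rightarrow> nat \<Rightarrow> real" where
  "ecc_transmission G vs i = (\<Sum>j<length vs. ecc_mat G vs $$ (i, j))"

definition ecc_laplacian :: "'a pair_pre_digraph \<Rightarrow> 'a list \<Rightarrow> real mat" where
  "ecc_laplacian G vs = mat_diag (length vs) (ecc_transmission G vs) - ecc_mat G vs"

definition ecc_signless_laplacian :: "'a pair_pre_digraph \<Rightarrow> 'a list \<Rightarrow> real mat" where
  "ecc_signless_laplacian G vs = mat_diag (length vs) (ecc_transmission G vs) + ecc_mat G vs"

text \<open>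
  One of the two zero diagonal blocks may be empty (\<open>k = 0\<close> or \<open>k = n\<close>), as for bipartite graphs
  with an empty colour class.  For an irreducible eccentricity matrix this only matters for the
  one-vertex graph.
\<close>

definition ecc_bipartite :: "'a pair_pre_digraph \<Rightarrow> bool" where
  "ecc_bipartite G \<longleftrightarrow>
     (\<exists>vs k B. vertex_labeling G vs \<and> k \<le> length vs \<and> B \<in> carrier_mat k (length vs - k) \<and>
        ecc_mat G vs =
          four_block_mat (0\<^sub>m k k) B (transpose_mat B) (0\<^sub>m (length vs - k) (length vs - k)))"

definition permutation_mat :: "nat \<Rightarrow> (nat \<Rightarrow> nat) \<Rightarrow> 'a :: semiring_1 mat" where
  "permutation_mat n p = mat n n (\<lambda>(i, j). if i = p j then 1 else 0)"

definition permutationally_similar :: "'a :: semiring_1 mat \<Rightarrow> 'a mat \<Rightarrow> bool" where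
  "permutationally_similar A B \<longleftrightarrow>
     (\<exists>n p. A \<in> carrier_mat n n \<and> p permutes {..<n} \<and>
        B = transpose_mat (permutation_mat n p) * A * permutation_mat n p)"

text \<open>
  Two diagonal blocks suffice in the definition of reducibility: a block upper triangular matrix
  with more of them is also one with two, by merging all but the first.
\<close>

definition reducible_mat :: "'a :: semiring_1 mat \<Rightarrow> bool" where
  "reducible_mat A \<longleftrightarrow>
     (\<exists>k m B C D. k > 0 \<and> m > 0 \<and>
        B \<in> carrier_mat k k \<and> C \<in> carrier_mat k m \<and> D \<in> carrier_mat m m \<and>
        permutationally_similar A (four_block_mat B C (0\<^sub>m m k) D))"

definition irreducible_mat :: "'a :: semiring_1 mat \<Rightarrow> bool" where
  "irreducible_mat A \<longleftrightarrow> \<not> reducible_mat A"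

definition spectrum_symmetric :: "complex mat \<Rightarrow> bool" where
  "spectrum_symmetric A \<longleftrightarrow>
     (\<forall>l \<in> spectrum A. - l \<in> spectrum A \<and> order (- l) (char_poly A) = order l (char_poly A))"

text \<open>The library's spectral radius is defined for complex matrices only.\<close>

abbreviation complex_mat :: "real mat \<Rightarrow> complex mat" where
  "complex_mat A \<equiv> map_mat complex_of_real A"

end

theory Submission
  imports Defs
begin

text \<open>
  The equivalence is a fact about a real, symmetric, nonnegative and irreducible matrix \<open>A\<close> with
  spectral radius \<open>\<rho>\<close>, of which the eccentricity matrix is an instance (\<open>bipartite_mat_tfae\<close>).

  If \<open>A\<close> is bipartite, the diagonal matrix \<open>D\<close> of the colour signs satisfies \<open>D A D = -A\<close> and
  commutes with diagonal matrices (\<open>bipartite_mat_similar\<close>).  Thus \<open>A\<close> is similar to \<open>-A\<close>, which makes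
  the spectrum symmetric, and the Laplacian is similar to the signless Laplacian.

  If the spectrum is symmetric, then \<open>-\<rho>\<close> is an eigenvalue, because all eigenvalues are real and
  one of them has modulus \<open>\<rho>\<close>.

  If \<open>-\<rho>\<close> is an eigenvalue, with eigenvector \<open>x\<close>, then \<open>\<bar>x\<bar>\<close> attains the Rayleigh bound
  \<open>y \<bullet> A y \<le> \<rho> (y \<bullet> y)\<close> (\<open>quadratic_form_le_spectral_radius\<close>) and is therefore an eigenvector for
  \<open>\<rho>\<close> (\<open>quadratic_form_max_imp_eigenvector\<close>).  Equality in the triangle inequality forces
  \<open>x\<^sub>i x\<^sub>j \<le> 0\<close> wherever \<open>A\<^sub>i\<^sub>j \<noteq> 0\<close>, and irreducibility excludes zero components of \<open>x\<close>.  The signs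
  of \<open>x\<close> are the two colours (\<open>bipartite_mat_if_sign_pattern\<close>).

  If the two Laplacians are similar, the signless one is singular like the other one, and a
  vector in its kernel has the same kind of sign pattern, since the quadratic form of the signless
  Laplacian is half the sum of \<open>A\<^sub>i\<^sub>j (x\<^sub>i + x\<^sub>j)\<^sup>2\<close> over all \<open>i\<close> and \<open>j\<close>.
\<close>

section \<open>Symmetric real matrices have real spectrum\<close>

lemma scalar_prod_self_nonneg: "0 \<le> (x :: real vec) \<bullet> x"
  by (auto simp: scalar_prod_def intro: sum_nonneg)

lemma scalar_prod_self_eq_0:
  assumes "(x :: real vec) \<in> carrier_vec n" and "x \<bullet> x = 0"
  shows "x = 0\<^sub>v n"
proof -
  have "\<forall>i \<in> {0..<n}. x $ i * x $ i = 0"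
    using assms by (subst sum_nonneg_eq_0_iff[symmetric]) (auto simp: scalar_prod_def)
  then show ?thesis
    using assms(1) by (intro eq_vecI) auto
qed

lemma scalar_prod_Cauchy_Schwarz:
  assumes "(x :: real vec) \<in> carrier_vec n" and "y \<in> carrier_vec n"
  shows "(x \<bullet> y)\<^sup>2 \<le> (x \<bullet> x) * (y \<bullet> y)"
proof (cases "y \<bullet> y = 0")
  case True
  then show ?thesis
    using scalar_prod_self_eq_0[OF assms(2)] assms(1) by simp
next
  case False
  then have pos: "0 < y \<bullet> y"
    using scalar_prod_self_nonneg[of y] by simp
  define z where "z = (y \<bullet> y) \<cdot>\<^sub>v x - (x \<bullet> y) \<cdot>\<^sub>v y"
  have "z \<bullet> z = (y \<bullet> y) * ((y \<bullet> y) * (x \<bullet> x) - (x \<bullet> y)\<^sup>2)"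
    using assms comm_scalar_prod[OF assms(2,1)]
    by (simp add: z_def minus_scalar_prod_distrib[of _ n] scalar_prod_minus_distrib[of _ n]
        power2_eq_square algebra_simps)
  then have "0 \<le> (y \<bullet> y) * ((y \<bullet> y) * (x \<bullet> x) - (x \<bullet> y)\<^sup>2)"
    using scalar_prod_self_nonneg[of z] by simp
  then show ?thesis
    using pos by (simp add: zero_le_mult_iff mult.commute)
qed

lemma symmetric_mat_adjoint:
  assumes "(A :: real mat) \<in> carrier_mat n n" and "transpose_mat A = A"
    and "x \<in> carrier_vec n" and "y \<in> carrier_vec n"
  shows "(A *\<^sub>v x) \<bullet> y = x \<bullet> (A *\<^sub>v y)"
  using transpose_vec_mult_scalar[OF assms(1) assms(4) assms(3)] assms(2) by simp

lemma eigenvalue_complex_mat_of_real: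
  assumes "A \<in> carrier_mat n n"
  shows "eigenvalue (complex_mat A) (complex_of_real r) \<longleftrightarrow> eigenvalue A r"
proof -
  have "complex_mat A \<in> carrier_mat n n"
    using assms by simp
  then show ?thesis
    by (simp add: eigenvalue_root_char_poly[of _ n] assms of_real_hom.char_poly_hom[OF assms]
        of_real_hom.poly_map_poly)
qed

text \<open>
  Split an eigenvector for \<open>l\<close> into real and imaginary part, \<open>v = x + i y\<close>.  Comparing
  \<open>A x \<bullet> y\<close> with \<open>x \<bullet> A y\<close>, which agree by symmetry, leaves
  \<open>Im l * (x \<bullet> x + y \<bullet> y) = 0\<close>.
\<close>

lemma symmetric_mat_eigenvalue_real:
  assumes A: "A \<in> carrier_mat n n" and sym: "transpose_mat A = A"
    and l: "eigenvalue (complex_mat A) l"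
  shows "l \<in> \<real>"
proof -
  obtain v where v: "v \<in> carrier_vec n" "v \<noteq> 0\<^sub>v n" "complex_mat A *\<^sub>v v = l \<cdot>\<^sub>v v"
    using l A unfolding eigenvalue_def eigenvector_def by auto
  define x y where "x = map_vec Re v" and "y = map_vec Im v"
  have xy: "x \<in> carrier_vec n" "y \<in> carrier_vec n"
    using v(1) by (auto simp: x_def y_def)
  have Re: "A *\<^sub>v x = Re l \<cdot>\<^sub>v x - Im l \<cdot>\<^sub>v y"
  proof (intro eq_vecI)
    fix i assume "i < dim_vec (Re l \<cdot>\<^sub>v x - Im l \<cdot>\<^sub>v y)"
    then have i: "i < n" using xy by simp
    have "(A *\<^sub>v x) $ i = Re ((complex_mat A *\<^sub>v v) $ i)"
      using i A v(1) by (simp add: scalar_prod_def x_def)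
    then show "(A *\<^sub>v x) $ i = (Re l \<cdot>\<^sub>v x - Im l \<cdot>\<^sub>v y) $ i"
      using i v by (simp add: x_def y_def)
  qed (use A xy in simp)
  have Im: "A *\<^sub>v y = Im l \<cdot>\<^sub>v x + Re l \<cdot>\<^sub>v y"
  proof (intro eq_vecI)
    fix i assume "i < dim_vec (Im l \<cdot>\<^sub>v x + Re l \<cdot>\<^sub>v y)"
    then have i: "i < n" using xy by simp
    have "(A *\<^sub>v y) $ i = Im ((complex_mat A *\<^sub>v v) $ i)"
      using i A v(1) by (simp add: scalar_prod_def y_def)
    then show "(A *\<^sub>v y) $ i = (Im l \<cdot>\<^sub>v x + Re l \<cdot>\<^sub>v y) $ i"
      using i v by (simp add: x_def y_def)
  qed (use A xy in simp)
  have "(A *\<^sub>v x) \<bullet> y = x \<bullet> (A *\<^sub>v y)"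
    by (rule symmetric_mat_adjoint[OF A sym xy])
  then have "Im l * (x \<bullet> x + y \<bullet> y) = 0"
    unfolding Re Im using xy
    by (simp add: minus_scalar_prod_distrib[of _ n] scalar_prod_add_distrib[of _ n] algebra_simps)
  moreover have "x \<bullet> x + y \<bullet> y \<noteq> 0"
  proof
    assume "x \<bullet> x + y \<bullet> y = 0"
    then have "x \<bullet> x = 0" "y \<bullet> y = 0"
      using scalar_prod_self_nonneg[of x] scalar_prod_self_nonneg[of y] by linarith+
    then have z: "x = 0\<^sub>v n" "y = 0\<^sub>v n"
      using xy scalar_prod_self_eq_0 by blast+
    have "v = 0\<^sub>v n"
    proof (intro eq_vecI)
      fix i assume "i < dim_vec (0\<^sub>v n :: complex vec)"
      then have "i < n" by simp
      then show "v $ i = 0\<^sub>v n $ i"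
        using arg_cong[OF z(1), of "\<lambda>u. u $ i"] arg_cong[OF z(2), of "\<lambda>u. u $ i"] v(1)
        by (simp add: x_def y_def complex_eq_iff)
    qed (use v in simp)
    then show False using v(2) by simp
  qed
  ultimately have "Im l = 0" by simp
  then show ?thesis
    by (simp add: complex_is_Real_iff)
qed

section \<open>The spectral radius bounds the quadratic form\<close>

lemma pow_mat_smult:
  assumes "(A :: 'a :: comm_semiring_1 mat) \<in> carrier_mat n n"
  shows "(c \<cdot>\<^sub>m A) ^\<^sub>m k = c ^ k \<cdot>\<^sub>m A ^\<^sub>m k"
proof (induction k)
  case (Suc k)
  have "(c \<cdot>\<^sub>m A) ^\<^sub>m Suc k = (c ^ k \<cdot>\<^sub>m A ^\<^sub>m k) * (c \<cdot>\<^sub>m A)"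
    using Suc by simp
  also have "\<dots> = c ^ Suc k \<cdot>\<^sub>m A ^\<^sub>m Suc k"
    using assms pow_carrier_mat[OF assms, of k]
    by (intro eq_matI) (auto simp: scalar_prod_def sum_distrib_left ac_simps)
  finally show ?case .
qed (use assms in \<open>auto intro: eq_matI\<close>)

lemma eigenvalue_smult:
  assumes "(A :: 'a :: field mat) \<in> carrier_mat n n" and "c \<noteq> 0" and "eigenvalue (c \<cdot>\<^sub>m A) l"
  shows "eigenvalue A (l / c)"
proof -
  obtain v where v: "v \<in> carrier_vec n" "v \<noteq> 0\<^sub>v n" "(c \<cdot>\<^sub>m A) *\<^sub>v v = l \<cdot>\<^sub>v v"
    using assms unfolding eigenvalue_def eigenvector_def by auto
  have "A *\<^sub>v v = (l / c) \<cdot>\<^sub>v v"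
  proof (intro eq_vecI)
    fix i assume "i < dim_vec ((l / c) \<cdot>\<^sub>v v)"
    then have i: "i < n" using v by simp
    have "c * (A *\<^sub>v v) $ i = ((c \<cdot>\<^sub>m A) *\<^sub>v v) $ i"
      using i assms v(1) by (simp add: scalar_prod_def sum_distrib_left ac_simps)
    also have "\<dots> = l * v $ i"
      unfolding v(3) using i v(1) by simp
    finally show "(A *\<^sub>v v) $ i = ((l / c) \<cdot>\<^sub>v v) $ i"
      using i v(1) assms(2) by (simp add: field_simps)
  qed (use assms v in simp)
  then show ?thesis
    using v assms unfolding eigenvalue_def eigenvector_def by auto
qed

text \<open>
  For \<open>\<mu>\<close> above the spectral radius, the powers of \<open>A / \<mu>\<close> have bounded entries, because that
  matrix has spectral radius less than one.
\<close>

lemma power_growth_le_above_spectral_radius: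
  assumes A: "A \<in> carrier_mat n n" and n: "n > 0" and x: "x \<in> carrier_vec n"
    and mu: "spectral_radius (complex_mat A) < \<mu>" "0 < \<mu>"
  shows "\<exists>C. \<forall>k. (A ^\<^sub>m k *\<^sub>v x) \<bullet> (A ^\<^sub>m k *\<^sub>v x) \<le> C * \<mu> ^ (2 * k)"
proof -
  let ?B = "complex_of_real (1 / \<mu>) \<cdot>\<^sub>m complex_mat A"
  have cA: "complex_mat A \<in> carrier_mat n n" and B: "?B \<in> carrier_mat n n"
    using A by auto
  obtain l where l: "eigenvalue ?B l" "spectral_radius ?B = norm l"
    using spectral_radius_mem_max(1)[OF B n] unfolding spectrum_def by auto
  have "eigenvalue (complex_mat A) (l / complex_of_real (1 / \<mu>))"
    using mu l(1) by (intro eigenvalue_smult[OF cA]) auto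
  then have "norm (l / complex_of_real (1 / \<mu>)) \<le> spectral_radius (complex_mat A)"
    by (intro spectral_radius_mem_max(2)[OF cA n]) (auto simp: spectrum_def)
  then have "norm l * \<mu> \<le> spectral_radius (complex_mat A)"
    using mu by (simp add: norm_divide norm_mult)
  then have "norm l * \<mu> < 1 * \<mu>"
    using mu by linarith
  then have "spectral_radius ?B < 1"
    using mu l(2) by simp
  then obtain c where c: "\<And>k. norm_bound (?B ^\<^sub>m k) c"
    using spectral_radius_jnf_norm_bound_less_1_upper_triangular[OF B] by blast
  define S where "S = (\<Sum>j<n. \<bar>x $ j\<bar>)"
  have entry: "\<bar>(A ^\<^sub>m k) $$ (i, j)\<bar> \<le> c * \<mu> ^ k" if "i < n" "j < n" for i j k
  proof -
    have "?B ^\<^sub>m k = complex_of_real (1 / \<mu>) ^ k \<cdot>\<^sub>m complex_mat (A ^\<^sub>m k)"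
      by (simp only: pow_mat_smult[OF cA] of_real_hom.mat_hom_pow[OF A])
    then have "norm (complex_of_real (1 / \<mu>) ^ k * complex_of_real ((A ^\<^sub>m k) $$ (i, j))) \<le> c"
      using c[of k] that A pow_carrier_mat[OF A, of k] unfolding norm_bound_def by simp
    then show ?thesis
      using mu by (simp add: norm_mult norm_power norm_divide field_simps)
  qed
  have comp: "((A ^\<^sub>m k *\<^sub>v x) $ i)\<^sup>2 \<le> (c * S)\<^sup>2 * \<mu> ^ (2 * k)" if i: "i < n" for i k
  proof -
    have "\<bar>(A ^\<^sub>m k *\<^sub>v x) $ i\<bar> = \<bar>\<Sum>j<n. (A ^\<^sub>m k) $$ (i, j) * x $ j\<bar>"
      using i x A pow_carrier_mat[OF A, of k]
      by (simp add: scalar_prod_def atLeast0LessThan)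
    also have "\<dots> \<le> (\<Sum>j<n. \<bar>(A ^\<^sub>m k) $$ (i, j)\<bar> * \<bar>x $ j\<bar>)"
      using sum_abs[of "\<lambda>j. (A ^\<^sub>m k) $$ (i, j) * x $ j" "{..<n}"] by (simp add: abs_mult)
    also have "\<dots> \<le> (\<Sum>j<n. c * \<mu> ^ k * \<bar>x $ j\<bar>)"
      using i entry by (intro sum_mono mult_right_mono) auto
    also have "\<dots> = c * S * \<mu> ^ k"
      by (simp add: S_def sum_distrib_left ac_simps)
    finally have "\<bar>(A ^\<^sub>m k *\<^sub>v x) $ i\<bar>\<^sup>2 \<le> (c * S * \<mu> ^ k)\<^sup>2"
      by (intro power_mono) auto
    then show ?thesis
      by (simp add: power_mult_distrib power_mult[symmetric] mult.commute)
  qed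
  have "(A ^\<^sub>m k *\<^sub>v x) \<bullet> (A ^\<^sub>m k *\<^sub>v x) \<le> (real n * (c * S)\<^sup>2) * \<mu> ^ (2 * k)" for k
  proof -
    have "(A ^\<^sub>m k *\<^sub>v x) \<bullet> (A ^\<^sub>m k *\<^sub>v x) = (\<Sum>i<n. ((A ^\<^sub>m k *\<^sub>v x) $ i)\<^sup>2)"
      using A pow_carrier_mat[OF A, of k]
      by (simp add: scalar_prod_def[of "A ^\<^sub>m k *\<^sub>v x"] atLeast0LessThan power2_eq_square)
    also have "\<dots> \<le> (\<Sum>i<n. (c * S)\<^sup>2 * \<mu> ^ (2 * k))"
      using comp by (intro sum_mono) auto
    finally show ?thesis by simp
  qed
  then show ?thesis by blast
qed

text \<open>
  The Rayleigh bound, obtained from growth rates instead of an orthonormal eigenbasis.  Let \<open>\<mu>\<close> be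
  the Rayleigh quotient of \<open>x\<close>.  For symmetric \<open>A\<close>, the squared norms \<open>b k\<close> of \<open>A\<^sup>k x\<close> are
  log-convex by the Cauchy-Schwarz inequality, so the ratios of successive terms never fall below the
  first one, and that one is at least \<open>\<mu>\<^sup>2\<close>.  Hence \<open>A\<^sup>k x\<close> grows at least like \<open>\<mu>\<^sup>k\<close>, which is
  impossible if \<open>\<mu>\<close> exceeds the spectral radius.
\<close>

lemma quadratic_form_le_spectral_radius:
  assumes A: "A \<in> carrier_mat n n" and sym: "transpose_mat A = A"
    and n: "n > 0" and x: "x \<in> carrier_vec n"
  shows "x \<bullet> (A *\<^sub>v x) \<le> spectral_radius (complex_mat A) * (x \<bullet> x)"
proof (rule ccontr)
  let ?\<rho> = "spectral_radius (complex_mat A)"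
  assume "\<not> ?thesis"
  then have gt: "?\<rho> * (x \<bullet> x) < x \<bullet> (A *\<^sub>v x)" by simp
  have "x \<noteq> 0\<^sub>v n"
    using gt A by auto
  then have xx: "0 < x \<bullet> x"
    using scalar_prod_self_eq_0[OF x] scalar_prod_self_nonneg[of x] by fastforce
  define \<mu> where "\<mu> = (x \<bullet> (A *\<^sub>v x)) / (x \<bullet> x)"
  have "?\<rho> < \<mu>"
    using gt xx by (simp add: \<mu>_def field_simps)
  then obtain \<nu> where \<nu>: "?\<rho> < \<nu>" "\<nu> < \<mu>"
    using dense by blast
  have cA: "complex_mat A \<in> carrier_mat n n"
    using A by simp
  have "0 \<le> ?\<rho>"
    using spectral_radius_mem_max(1)[OF cA n] by auto
  then have pos: "0 < \<nu>" "0 < \<mu>"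
    using \<nu> by auto
  define y where "y = (\<lambda>k. A ^\<^sub>m k *\<^sub>v x)"
  have y: "y k \<in> carrier_vec n" for k
    using A x by (auto simp: y_def intro: mult_mat_vec_carrier[OF pow_carrier_mat])
  have y_Suc: "y (Suc k) = A *\<^sub>v y k" for k
  proof -
    have "A ^\<^sub>m Suc k = A * A ^\<^sub>m k"
    proof (induction k)
      case (Suc k)
      have "A ^\<^sub>m Suc (Suc k) = (A * A ^\<^sub>m k) * A"
        using Suc by simp
      then show ?case
        using A by (simp add: assoc_mult_mat[of _ n n _ n _ n])
    qed (use A in auto)
    then show ?thesis
      using A x by (simp add: y_def assoc_mult_mat_vec[of _ n n _ n])
  qed
  define b where "b = (\<lambda>k. y k \<bullet> y k)"
  have b0: "b 0 = x \<bullet> x"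
    using A x by (simp add: b_def y_def)
  have logconvex: "(b (Suc k))\<^sup>2 \<le> b k * b (Suc (Suc k))" for k
  proof -
    have "b (Suc k) = y k \<bullet> y (Suc (Suc k))"
      using symmetric_mat_adjoint[OF A sym y y, of k "Suc k"] by (simp add: b_def y_Suc)
    then show ?thesis
      using scalar_prod_Cauchy_Schwarz[OF y y, of k "Suc (Suc k)"] by (simp add: b_def)
  qed
  have ratio: "0 < b k \<and> \<mu>\<^sup>2 * b k \<le> b (Suc k)" for k
  proof (induction k)
    case 0
    have "(\<mu> * (x \<bullet> x))\<^sup>2 \<le> (x \<bullet> x) * b (Suc 0)"
      using scalar_prod_Cauchy_Schwarz[OF y y, of 0 "Suc 0"] xx A x
      by (simp add: \<mu>_def b_def y_Suc) (simp add: y_def)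
    then have "(x \<bullet> x) * (\<mu>\<^sup>2 * (x \<bullet> x)) \<le> (x \<bullet> x) * b (Suc 0)"
      by (simp add: power2_eq_square ac_simps)
    then show ?case
      using xx b0 by simp
  next
    case (Suc k)
    then have pos': "0 < b (Suc k)"
      using pos less_le_trans[OF mult_pos_pos[of "\<mu>\<^sup>2" "b k"]] by simp
    have "b k * (\<mu>\<^sup>2 * b (Suc k)) = (\<mu>\<^sup>2 * b k) * b (Suc k)"
      by simp
    also have "\<dots> \<le> b (Suc k) * b (Suc k)"
      using Suc pos' by (intro mult_right_mono) auto
    also have "\<dots> = (b (Suc k))\<^sup>2"
      by (rule power2_eq_square[symmetric])
    also have "\<dots> \<le> b k * b (Suc (Suc k))"
      by (rule logconvex)
    finally show ?case
      using Suc pos' by simp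
  qed
  have grow: "b 0 * (\<mu>\<^sup>2) ^ k \<le> b k" for k
  proof (induction k)
    case (Suc k)
    have "b 0 * (\<mu>\<^sup>2) ^ Suc k \<le> \<mu>\<^sup>2 * b k"
      using mult_left_mono[OF Suc, of "\<mu>\<^sup>2"] by (simp add: ac_simps)
    then show ?case
      using ratio[of k] by linarith
  qed simp
  obtain C where C: "\<And>k. b k \<le> C * \<nu> ^ (2 * k)"
    using power_growth_le_above_spectral_radius[OF A n x \<nu>(1) pos(1)] by (auto simp: b_def y_def)
  have bound: "((\<mu> / \<nu>)\<^sup>2) ^ k \<le> C / b 0" for k
  proof -
    have "b 0 * (\<mu>\<^sup>2) ^ k \<le> C * (\<nu>\<^sup>2) ^ k"
      using grow[of k] C[of k] by (simp add: power_mult)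
    then show ?thesis
      using pos xx b0 by (simp add: power_divide field_simps)
  qed
  have "1 < (\<mu> / \<nu>)\<^sup>2"
    using pos \<nu> by (simp add: one_less_power)
  then obtain k where "C / b 0 < ((\<mu> / \<nu>)\<^sup>2) ^ k"
    using real_arch_pow by blast
  then show False
    using bound[of k] by simp
qed

text \<open>
  First-order condition at a maximizer.  With the defect \<open>w = A x - \<rho> x\<close>, moving \<open>z\<close> from \<open>x\<close> to
  \<open>x + t w\<close> changes \<open>z \<bullet> A z - \<rho> (z \<bullet> z)\<close> from \<open>0\<close> to \<open>2 t (w \<bullet> w)\<close> plus a term quadratic in
  \<open>t\<close>.  The Rayleigh bound forbids a positive value for small \<open>t > 0\<close>, so \<open>w = 0\<close>.
\<close>

lemma quadratic_form_max_imp_eigenvector: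
  assumes A: "A \<in> carrier_mat n n" and sym: "transpose_mat A = A"
    and n: "n > 0" and x: "x \<in> carrier_vec n"
    and max: "x \<bullet> (A *\<^sub>v x) = spectral_radius (complex_mat A) * (x \<bullet> x)"
  shows "A *\<^sub>v x = spectral_radius (complex_mat A) \<cdot>\<^sub>v x"
proof -
  define \<rho> where "\<rho> = spectral_radius (complex_mat A)"
  define w where "w = A *\<^sub>v x - \<rho> \<cdot>\<^sub>v x"
  have Ax: "A *\<^sub>v x \<in> carrier_vec n" and w: "w \<in> carrier_vec n" and Aw: "A *\<^sub>v w \<in> carrier_vec n"
    using A x by (auto simp: w_def)
  define a b c d where "a = x \<bullet> x" and "b = w \<bullet> x" and "c = w \<bullet> w" and "d = w \<bullet> (A *\<^sub>v w)"
  have xw: "x \<bullet> w = b"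
    using comm_scalar_prod[OF x w] by (simp add: b_def)
  have Ax_eq: "A *\<^sub>v x = w + \<rho> \<cdot>\<^sub>v x"
    using A x unfolding w_def by (intro eq_vecI) auto
  then have wAx: "w \<bullet> (A *\<^sub>v x) = c + \<rho> * b"
    using w x by (simp add: scalar_prod_add_distrib[of _ n] b_def c_def)
  have xAw: "x \<bullet> (A *\<^sub>v w) = c + \<rho> * b"
    using symmetric_mat_adjoint[OF A sym x w] comm_scalar_prod[OF Ax w] wAx by simp
  have ineq: "2 * t * c \<le> t\<^sup>2 * (\<rho> * c - d)" for t
  proof -
    define z where "z = x + t \<cdot>\<^sub>v w"
    have "z \<in> carrier_vec n"
      using x w by (simp add: z_def)
    then have "z \<bullet> (A *\<^sub>v z) \<le> \<rho> * (z \<bullet> z)"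
      unfolding \<rho>_def by (rule quadratic_form_le_spectral_radius[OF A sym n])
    moreover have "A *\<^sub>v z = A *\<^sub>v x + t \<cdot>\<^sub>v (A *\<^sub>v w)"
      using A x w by (simp add: z_def mult_add_distrib_mat_vec[of _ n n] mult_mat_vec[of _ n n])
    then have "z \<bullet> (A *\<^sub>v z) = \<rho> * a + 2 * t * (c + \<rho> * b) + t\<^sup>2 * d"
      using x w Ax Aw wAx xAw max
      by (simp add: z_def scalar_prod_add_distrib[of _ n] add_scalar_prod_distrib[of _ n]
          a_def d_def \<rho>_def power2_eq_square algebra_simps)
    moreover have "z \<bullet> z = a + 2 * t * b + t\<^sup>2 * c"
      using x w xw
      by (simp add: z_def scalar_prod_add_distrib[of _ n] add_scalar_prod_distrib[of _ n]
          a_def b_def c_def power2_eq_square algebra_simps)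
    ultimately show ?thesis
      by (simp add: algebra_simps)
  qed
  have "c = 0"
  proof (rule ccontr)
    assume "c \<noteq> 0"
    then have c: "0 < c"
      using scalar_prod_self_nonneg[of w] by (simp add: c_def)
    \<comment> \<open>The choice \<open>t = c / K\<close> makes the right-hand side of \<open>ineq\<close> at most half of the left-hand side.\<close>
    define K where "K = \<bar>\<rho> * c - d\<bar> + 1"
    have K: "0 < K" "\<rho> * c - d \<le> K"
      by (auto simp: K_def)
    have "2 * (c / K) * c \<le> (c / K)\<^sup>2 * (\<rho> * c - d)"
      by (rule ineq)
    also have "\<dots> \<le> (c / K)\<^sup>2 * K"
      by (rule mult_left_mono[OF K(2)]) simp
    finally have "2 * (c / K * c) \<le> (c / K)\<^sup>2 * K"
      by (simp only: mult.assoc)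
    moreover have "(c / K)\<^sup>2 * K = c / K * c"
      using K by (simp add: power2_eq_square)
    moreover have "0 < c / K * c"
      using c K by simp
    ultimately show False
      by linarith
  qed
  then have "w = 0\<^sub>v n"
    using scalar_prod_self_eq_0[OF w] by (simp add: c_def)
  then have "A *\<^sub>v x = 0\<^sub>v n + \<rho> \<cdot>\<^sub>v x"
    using Ax_eq by (simp only:)
  also have "\<dots> = \<rho> \<cdot>\<^sub>v x"
    using x by simp
  finally show ?thesis
    unfolding \<rho>_def .
qed

lemma scalar_prod_mult_mat_vec_eq_sum:
  assumes "(A :: 'a :: comm_semiring_0 mat) \<in> carrier_mat n n"
    and "x \<in> carrier_vec n" and "y \<in> carrier_vec n"
  shows "x \<bullet> (A *\<^sub>v y) = (\<Sum>i<n. \<Sum>j<n. A $$ (i, j) * (x $ i * y $ j))"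
proof -
  have "x \<bullet> (A *\<^sub>v y) = (\<Sum>i<n. x $ i * (\<Sum>j<n. A $$ (i, j) * y $ j))"
    using assms by (simp add: scalar_prod_def atLeast0LessThan)
  also have "\<dots> = (\<Sum>i<n. \<Sum>j<n. A $$ (i, j) * (x $ i * y $ j))"
    unfolding sum_distrib_left by (intro sum.cong refl mult.left_commute)
  finally show ?thesis .
qed

section \<open>Irreducibility and sign patterns\<close>

lemma exists_permutation_initial_segment:
  assumes "U \<subseteq> {..<n}"
  obtains p where "p permutes {..<n}" and "p ` {..<card U} = U"
proof -
  have fin: "finite U" "card U \<le> n"
    using assms finite_subset card_mono[OF _ assms] by auto
  obtain f where f: "bij_betw f {..<card U} U"
    using finite_same_card_bij[of "{..<card U}" U] fin by auto
  have "card ({..<n} - U) = n - card U"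
    using assms fin by (simp add: card_Diff_subset)
  then obtain g where g: "bij_betw g {card U..<n} ({..<n} - U)"
    using finite_same_card_bij[of "{card U..<n}" "{..<n} - U"] by auto
  define p where "p i = (if i < card U then f i else if i < n then g i else i)" for i
  have "bij_betw p {..<card U} U"
    using f by (subst bij_betw_cong[of _ _ f]) (auto simp: p_def)
  moreover have "bij_betw p {card U..<n} ({..<n} - U)"
    using g by (subst bij_betw_cong[of _ _ g]) (auto simp: p_def)
  ultimately have "bij_betw p ({..<card U} \<union> {card U..<n}) (U \<union> ({..<n} - U))"
    by (rule bij_betw_combine) auto
  moreover have "{..<card U} \<union> {card U..<n} = {..<n}" "U \<union> ({..<n} - U) = {..<n}"
    using assms fin by auto
  ultimately have "p permutes {..<n}"
    using fin by (intro bij_imp_permutes) (auto simp: p_def)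
  moreover have "p ` {..<card U} = U"
    using \<open>bij_betw p {..<card U} U\<close> by (rule bij_betw_imp_surj_on)
  ultimately show thesis by (rule that)
qed

lemma permutation_mat_conjugate:
  assumes "A \<in> carrier_mat n n" and "p permutes {..<n}"
  shows "transpose_mat (permutation_mat n p) * A * permutation_mat n p
    = mat n n (\<lambda>(i, j). A $$ (p i, p j))"
proof (intro eq_matI)
  fix i j assume "i < dim_row (mat n n (\<lambda>(i, j). A $$ (p i, p j)))"
    and "j < dim_col (mat n n (\<lambda>(i, j). A $$ (p i, p j)))"
  then have ij: "i < n" "j < n" by auto
  have p: "p k < n" if "k < n" for k
    using permutes_in_image[OF assms(2), of k] that by simp
  have "(transpose_mat (permutation_mat n p) * A) $$ (i, l) = A $$ (p i, l)" if "l < n" for l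
    using ij that p assms(1)
    by (simp add: permutation_mat_def scalar_prod_def if_distrib[of "\<lambda>c. c * _"] cong: if_cong)
  then show "(transpose_mat (permutation_mat n p) * A * permutation_mat n p) $$ (i, j)
    = mat n n (\<lambda>(i, j). A $$ (p i, p j)) $$ (i, j)"
    using ij p assms(1)
    by (simp add: permutation_mat_def scalar_prod_def[of "row _ _"] if_distrib[of "\<lambda>c. _ * c"] cong: if_cong)
qed (use assms(1) in \<open>auto simp: permutation_mat_def\<close>)

text \<open>
  Listing the indices in \<open>U\<close> first would exhibit \<open>A\<close> as block upper triangular if both \<open>U\<close> and its
  complement were nonempty.
\<close>

lemma irreducible_mat_closed_set:
  assumes A: "A \<in> carrier_mat n n" and irr: "irreducible_mat A"
    and U: "U \<subseteq> {..<n}" "U \<noteq> {}"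
    and zero: "\<And>i j. i < n \<Longrightarrow> i \<notin> U \<Longrightarrow> j \<in> U \<Longrightarrow> A $$ (i, j) = 0"
  shows "U = {..<n}"
proof (rule ccontr)
  assume "U \<noteq> {..<n}"
  then have "U \<subset> {..<n}" using U by auto
  then have lt: "card U < n"
    using psubset_card_mono[of "{..<n}" U] by simp
  have "finite U" using U finite_subset by auto
  then have gt: "0 < card U" using U by (simp add: card_gt_0_iff)
  obtain p where p: "p permutes {..<n}" "p ` {..<card U} = U"
    using exists_permutation_initial_segment[OF U(1)] .
  define k m where "k = card U" and "m = n - card U"
  let ?M = "mat n n (\<lambda>(i, j). A $$ (p i, p j))"
  let ?B = "mat k k (\<lambda>(i, j). ?M $$ (i, j))"
  let ?C = "mat k m (\<lambda>(i, j). ?M $$ (i, j + k))"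
  let ?D = "mat m m (\<lambda>(i, j). ?M $$ (i + k, j + k))"
  have km: "k > 0" "m > 0" "k + m = n"
    using lt gt by (auto simp: k_def m_def)
  have low: "A $$ (p i, p j) = 0" if "i < n" "\<not> i < k" "j < k" for i j
  proof (rule zero)
    show "p i < n"
      using permutes_in_image[OF p(1), of i] that by simp
    show "p j \<in> U"
      using p(2) that by (auto simp: k_def)
    show "p i \<notin> U"
    proof
      assume "p i \<in> U"
      then obtain l where l: "l < k" "p i = p l"
        using p(2) by (auto simp: k_def)
      then have "i = l"
        using permutes_inj[OF p(1)] by (auto dest: injD)
      then show False using l that by simp
    qed
  qed
  have "?M = four_block_mat ?B ?C (0\<^sub>m m k) ?D"
    using km low by (intro eq_matI) (auto simp: four_block_mat_def Let_def)
  then have "permutationally_similar A (four_block_mat ?B ?C (0\<^sub>m m k) ?D)"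
    unfolding permutationally_similar_def
    using A p(1) permutation_mat_conjugate[OF A p(1)] by metis
  then have "reducible_mat A"
    unfolding reducible_mat_def using km
    by (intro exI[of _ k] exI[of _ m] exI[of _ ?B] exI[of _ ?C] exI[of _ ?D]) auto
  then show False
    using irr by (simp add: irreducible_mat_def)
qed

text \<open>
  \<open>S\<close> is one of the two colour classes of the indices.  The case \<open>i = j\<close> makes the diagonal vanish.
  Unlike the block form, this does not refer to an ordering of the indices.
\<close>

definition bipartite_mat :: "'a :: zero mat \<Rightarrow> nat set \<Rightarrow> bool" where
  "bipartite_mat A S \<longleftrightarrow>
     (\<forall>i < dim_row A. \<forall>j < dim_col A. (i \<in> S \<longleftrightarrow> j \<in> S) \<longrightarrow> A $$ (i, j) = 0)"

text \<open>
  The common last step of both ways to recover the colour classes from a vector.  The hypothesis says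
  that a nonzero entry never leads from the support of \<open>x\<close> to its complement, so irreducibility makes
  the support everything, and that nonzero entries join indices of opposite sign, so the sign of \<open>x\<close>
  is a proper colouring.
\<close>

lemma bipartite_mat_if_sign_pattern:
  assumes A: "A \<in> carrier_mat n n" and irr: "irreducible_mat A"
    and x: "x \<in> carrier_vec n" "x \<noteq> 0\<^sub>v n"
    and pattern: "\<And>i j. i < n \<Longrightarrow> j < n \<Longrightarrow> A $$ (i, j) \<noteq> 0 \<Longrightarrow>
      x $ j \<noteq> 0 \<Longrightarrow> x $ i * x $ j < (0 :: real)"
  shows "bipartite_mat A {i. 0 < x $ i}"
proof -
  let ?U = "{i. i < n \<and> x $ i \<noteq> 0}"
  have "?U \<noteq> {}"
  proof
    assume "?U = {}"
    then have "x = 0\<^sub>v n"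
      using x(1) by (intro eq_vecI) auto
    then show False using x(2) by simp
  qed
  then have "?U = {..<n}"
    using pattern by (intro irreducible_mat_closed_set[OF A irr]) fastforce+
  then have nz: "x $ i \<noteq> 0" if "i < n" for i
    using that by auto
  show ?thesis
    unfolding bipartite_mat_def
  proof (intro allI impI)
    fix i j assume "i < dim_row A" "j < dim_col A" and iff: "i \<in> {i. 0 < x $ i} \<longleftrightarrow> j \<in> {i. 0 < x $ i}"
    then have ij: "i < n" "j < n" using A by auto
    have "0 < x $ i * x $ j"
      using iff nz[OF ij(1)] nz[OF ij(2)] by (auto simp: zero_less_mult_iff)
    then show "A $$ (i, j) = 0"
      using pattern[OF ij] nz[OF ij(2)] by force
  qed
qed

section \<open>Consequences of bipartiteness\<close>

text \<open>
  Conjugation by the diagonal matrix of the signs \<open>+1\<close> on \<open>S\<close> and \<open>-1\<close> off \<open>S\<close> fixes diagonal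
  matrices and negates \<open>A\<close>.  Taking \<open>d = 0\<close> gives \<open>-A \<sim> A\<close>; taking the row sums gives the two
  Laplacians.
\<close>

lemma bipartite_mat_similar:
  assumes A: "(A :: 'a :: comm_ring_1 mat) \<in> carrier_mat n n" and S: "bipartite_mat A S"
  shows "similar_mat (mat_diag n d - A) (mat_diag n d + A)"
proof -
  let ?s = "\<lambda>i. if i \<in> S then 1 else - 1 :: 'a"
  let ?D = "mat_diag n ?s"
  have DD: "?D * ?D = 1\<^sub>m n"
    by (simp add: if_distrib[of "\<lambda>c. c * _"] cong: if_cong)
  have "?D * (mat_diag n d + A) * ?D = mat n n (\<lambda>(i, j). ?s i * (mat_diag n d + A) $$ (i, j) * ?s j)"
    using A by (subst mat_diag_mult_left[of _ n n], simp)
      (subst mat_diag_mult_right[of _ n n], auto intro: eq_matI)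
  also have "\<dots> = mat_diag n d - A"
    using A S by (intro eq_matI) (auto simp: mat_diag_def bipartite_mat_def)
  finally show ?thesis
    using A DD by (intro similar_matI[of _ _ ?D ?D n]) auto
qed

text \<open>
  A polynomial that the substitution \<open>X \<mapsto> -X\<close> merely scales has roots \<open>l\<close> and \<open>-l\<close> of equal multiplicity;
  this is how the similarity of \<open>-A\<close> and \<open>A\<close> yields the multiplicities in the symmetry of the
  spectrum.
\<close>

lemma order_uminus_eq_if_pcompose_smult:
  fixes q :: "'a :: field poly"
  assumes "q \<noteq> 0" and "c \<noteq> 0" and refl: "pcompose q [:0, - 1:] = Polynomial.smult c q"
  shows "order (- l) q = order l q"
proof -
  have le: "order l q \<le> order (- l) q" for l
  proof -
    obtain r where r: "q = [:- l, 1:] ^ order l q * r"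
      using order_1[of l q] by (elim dvdE)
    have power: "pcompose (f ^ k) g = pcompose f g ^ k" for f g :: "'a poly" and k
      by (induction k) (simp_all add: pcompose_mult)
    have "Polynomial.smult c q = pcompose ([:- l, 1:] ^ order l q) [:0, - 1:] * pcompose r [:0, - 1:]"
      using arg_cong[OF r, of "\<lambda>f. pcompose f [:0, - 1:]"] refl by (simp add: pcompose_mult)
    also have "pcompose ([:- l, 1:] ^ order l q) [:0, - 1:] = (- [:- (- l), 1:]) ^ order l q"
      by (simp add: power pcompose_pCons)
    also have "\<dots> = [:- (- l), 1:] ^ order l q * (- 1) ^ order l q"
      by (subst power_minus) (simp add: mult.commute)
    finally have "[:- (- l), 1:] ^ order l q dvd Polynomial.smult c q"
      by (simp only: mult.assoc dvd_triv_left)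
    then have "[:- (- l), 1:] ^ order l q dvd q"
      using assms(2) by (simp add: dvd_smult_iff)
    then show ?thesis
      using assms(1) order_divides by blast
  qed
  show ?thesis
    using le[of l] le[of "- l"] by simp
qed

lemma char_poly_uminus:
  assumes A: "(A :: 'a :: field_char_0 mat) \<in> carrier_mat n n"
  shows "char_poly (- A) = Polynomial.smult ((- 1) ^ n) (pcompose (char_poly A) [:0, - 1:])"
proof (rule poly_eq_poly_eq_iff[THEN iffD1], rule ext)
  fix k
  have *: "- char_matrix (- A) k = char_matrix A (- k)"
    using A by (intro eq_matI) (auto simp: char_matrix_def)
  have "poly (char_poly (- A)) k = det (char_matrix A (- k))"
    using A by (subst char_poly_matrix[of _ n]) (simp_all add: *)
  also have "\<dots> = det ((- 1) \<cdot>\<^sub>m (- char_matrix A (- k)))"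
    by (rule arg_cong[of _ _ det]) (auto intro: eq_matI)
  also have "\<dots> = (- 1) ^ n * poly (char_poly A) (- k)"
    using A by (simp add: char_poly_matrix[OF A] char_matrix_def)
  finally show "poly (char_poly (- A)) k
      = poly (Polynomial.smult ((- 1) ^ n) (pcompose (char_poly A) [:0, - 1:])) k"
    by (simp add: poly_pcompose)
qed

lemma spectrum_symmetric_if_similar_uminus:
  assumes A: "A \<in> carrier_mat n n" and sim: "similar_mat (- A) A"
  shows "spectrum_symmetric A"
proof -
  let ?q = "char_poly A"
  have q: "?q = Polynomial.smult ((- 1) ^ n) (pcompose ?q [:0, - 1:])"
    using char_poly_uminus[OF A] char_poly_similar[OF sim] by simp
  have "pcompose ?q [:0, - 1:] = Polynomial.smult ((- 1) ^ n) (Polynomial.smult ((- 1) ^ n) (pcompose ?q [:0, - 1:]))"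
    by (simp add: power_mult_distrib[symmetric])
  then have refl: "pcompose ?q [:0, - 1:] = Polynomial.smult ((- 1) ^ n) ?q"
    using q by simp
  have nz: "?q \<noteq> 0"
    using degree_monic_char_poly[OF A] by auto
  have ord: "order (- l) ?q = order l ?q" for l
    by (rule order_uminus_eq_if_pcompose_smult[OF nz _ refl]) simp
  have "- l \<in> spectrum A" if "l \<in> spectrum A" for l
    using that nz ord[of l] by (simp add: spectrum_root_char_poly[OF A] order_root)
  then show ?thesis
    using ord by (simp add: spectrum_symmetric_def)
qed

section \<open>Recovering the colour classes\<close>

lemma double_sum_nonneg_eq_0:
  fixes f :: "nat \<Rightarrow> nat \<Rightarrow> real"
  assumes "(\<Sum>i<n. \<Sum>j<n. f i j) = 0"
    and nonneg: "\<And>i j. i < n \<Longrightarrow> j < n \<Longrightarrow> 0 \<le> f i j"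
    and "i < n" and "j < n"
  shows "f i j = 0"
proof -
  have "\<forall>i \<in> {..<n}. (\<Sum>j<n. f i j) = 0"
    using assms(1) nonneg by (subst (asm) sum_nonneg_eq_0_iff) (auto intro: sum_nonneg)
  then have "\<forall>j \<in> {..<n}. f i j = 0"
    using assms(3) nonneg by (subst sum_nonneg_eq_0_iff[symmetric]) auto
  then show ?thesis
    using assms(4) by simp
qed

text \<open>
  Let \<open>A x = -\<rho> x\<close> and \<open>y = \<bar>x\<bar>\<close>.  As \<open>A\<close> is nonnegative,
  \<open>y \<bullet> A y \<ge> -(x \<bullet> A x) = \<rho> (y \<bullet> y)\<close>, and the Rayleigh bound turns this into an equality.  It has
  two consequences.  Every summand of \<open>y \<bullet> A y + x \<bullet> A x\<close> vanishes, so a nonzero entry joins only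
  indices with \<open>x\<^sub>i x\<^sub>j \<le> 0\<close>.  And \<open>y\<close> is an eigenvector for \<open>\<rho>\<close>, so a row of \<open>A\<close> with
  \<open>y\<^sub>i = 0\<close> is zero on the support of \<open>y\<close>.
\<close>

theorem bipartite_mat_if_uminus_spectral_radius:
  assumes A: "A \<in> carrier_mat n n" and n: "n > 0" and sym: "transpose_mat A = A"
    and nonneg: "\<And>i j. i < n \<Longrightarrow> j < n \<Longrightarrow> 0 \<le> A $$ (i, j)"
    and irr: "irreducible_mat A"
    and ev: "- complex_of_real (spectral_radius (complex_mat A)) \<in> spectrum (complex_mat A)"
  shows "\<exists>S. bipartite_mat A S"
proof -
  define \<rho> where "\<rho> = spectral_radius (complex_mat A)"
  have "eigenvalue (complex_mat A) (complex_of_real (- \<rho>))"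
    using ev by (simp add: spectrum_def \<rho>_def)
  then have "eigenvalue A (- \<rho>)"
    by (simp only: eigenvalue_complex_mat_of_real[OF A])
  then obtain x where x: "x \<in> carrier_vec n" "x \<noteq> 0\<^sub>v n" "A *\<^sub>v x = (- \<rho>) \<cdot>\<^sub>v x"
    using A unfolding eigenvalue_def eigenvector_def by auto
  define y where "y = map_vec abs x"
  have y: "y \<in> carrier_vec n"
    using x by (simp add: y_def)
  have yy: "y \<bullet> y = x \<bullet> x"
    using x(1) by (auto simp: y_def scalar_prod_def intro!: sum.cong)
  define T where "T i j = A $$ (i, j) * (\<bar>x $ i\<bar> * \<bar>x $ j\<bar> + x $ i * x $ j)" for i j
  have T_nonneg: "0 \<le> T i j" if "i < n" "j < n" for i j
  proof -
    have "- (x $ i * x $ j) \<le> \<bar>x $ i\<bar> * \<bar>x $ j\<bar>"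
      by (metis abs_ge_minus_self abs_mult)
    then show ?thesis
      unfolding T_def using nonneg[OF that] by (intro mult_nonneg_nonneg) auto
  qed
  have "(\<Sum>i<n. \<Sum>j<n. T i j) = y \<bullet> (A *\<^sub>v y) + x \<bullet> (A *\<^sub>v x)"
  proof -
    have "y \<bullet> (A *\<^sub>v y) = (\<Sum>i<n. \<Sum>j<n. A $$ (i, j) * (\<bar>x $ i\<bar> * \<bar>x $ j\<bar>))"
      unfolding scalar_prod_mult_mat_vec_eq_sum[OF A y y] using x(1) by (simp add: y_def)
    then show ?thesis
      unfolding scalar_prod_mult_mat_vec_eq_sum[OF A x(1) x(1)]
      by (simp only: T_def distrib_left sum.distrib)
  qed
  also have "x \<bullet> (A *\<^sub>v x) = - \<rho> * (y \<bullet> y)"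
    unfolding x(3) yy using x(1) by simp
  finally have sum_T: "(\<Sum>i<n. \<Sum>j<n. T i j) = y \<bullet> (A *\<^sub>v y) - \<rho> * (y \<bullet> y)"
    by simp
  moreover have "0 \<le> (\<Sum>i<n. \<Sum>j<n. T i j)"
    using T_nonneg by (intro sum_nonneg) auto
  moreover have "y \<bullet> (A *\<^sub>v y) \<le> \<rho> * (y \<bullet> y)"
    unfolding \<rho>_def by (rule quadratic_form_le_spectral_radius[OF A sym n y])
  ultimately have max: "y \<bullet> (A *\<^sub>v y) = \<rho> * (y \<bullet> y)" and sum0: "(\<Sum>i<n. \<Sum>j<n. T i j) = 0"
    by linarith+
  have T0: "T i j = 0" if "i < n" "j < n" for i j
    by (rule double_sum_nonneg_eq_0[OF sum0 T_nonneg that])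
  have Ay: "A *\<^sub>v y = \<rho> \<cdot>\<^sub>v y"
    unfolding \<rho>_def using max by (intro quadratic_form_max_imp_eigenvector[OF A sym n y]) (simp add: \<rho>_def)
  have closed: "A $$ (i, j) * \<bar>x $ j\<bar> = 0" if i: "i < n" "x $ i = 0" and j: "j < n" for i j
  proof -
    have "(\<Sum>j<n. A $$ (i, j) * \<bar>x $ j\<bar>) = (A *\<^sub>v y) $ i"
      using i A x(1) by (simp add: scalar_prod_def y_def atLeast0LessThan)
    also have "\<dots> = 0"
      unfolding Ay using i x(1) by (simp add: y_def)
    finally show ?thesis
      using nonneg i j by (subst (asm) sum_nonneg_eq_0_iff) auto
  qed
  have "bipartite_mat A {i. 0 < x $ i}"
  proof (rule bipartite_mat_if_sign_pattern[OF A irr x(1,2)])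
    fix i j assume ij: "i < n" "j < n" and nz: "A $$ (i, j) \<noteq> 0" "x $ j \<noteq> 0"
    have "x $ i \<noteq> 0"
      using closed[OF ij(1) _ ij(2)] nz by auto
    moreover have "x $ i * x $ j = - (\<bar>x $ i\<bar> * \<bar>x $ j\<bar>)"
      using T0[OF ij] nz by (simp add: T_def)
    ultimately show "x $ i * x $ j < 0"
      using nz by simp
  qed
  then show ?thesis by blast
qed

text \<open>
  The Laplacian annihilates the all-ones vector, so by similarity the signless Laplacian annihilates
  some \<open>x \<noteq> 0\<close>.  Twice its quadratic form is the sum of the nonnegative terms
  \<open>A\<^sub>i\<^sub>j (x\<^sub>i + x\<^sub>j)\<^sup>2\<close>, hence \<open>x\<^sub>i = -x\<^sub>j\<close> wherever \<open>A\<^sub>i\<^sub>j \<noteq> 0\<close>.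
\<close>

theorem bipartite_mat_if_laplacians_similar:
  fixes A :: "real mat"
  defines "r \<equiv> \<lambda>i. \<Sum>j<dim_row A. A $$ (i, j)"
  assumes A: "A \<in> carrier_mat n n" and n: "n > 0" and sym: "transpose_mat A = A"
    and nonneg: "\<And>i j. i < n \<Longrightarrow> j < n \<Longrightarrow> 0 \<le> A $$ (i, j)"
    and irr: "irreducible_mat A"
    and sim: "similar_mat (mat_diag n r - A) (mat_diag n r + A)"
  shows "\<exists>S. bipartite_mat A S"
proof -
  let ?L = "mat_diag n r - A" and ?Q = "mat_diag n r + A"
  have L: "?L \<in> carrier_mat n n" and Q: "?Q \<in> carrier_mat n n"
    using A by auto
  have r: "r i = (\<Sum>j<n. A $$ (i, j))" for i
    using A by (simp add: r_def)
  define e where "e = vec n (\<lambda>_. 1 :: real)"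
  have "e $ 0 \<noteq> 0\<^sub>v n $ 0"
    using n by (simp add: e_def)
  then have "e \<noteq> 0\<^sub>v n"
    by auto
  moreover have "?L *\<^sub>v e = 0 \<cdot>\<^sub>v e"
    using A by (intro eq_vecI)
      (auto simp: e_def scalar_prod_def mat_diag_def r atLeast0LessThan sum_subtractf)
  ultimately have "eigenvalue ?L 0"
    using A unfolding eigenvalue_def eigenvector_def by (intro exI[of _ e]) (auto simp: e_def)
  then have "eigenvalue ?Q 0"
    using char_poly_similar[OF sim] eigenvalue_root_char_poly[OF L] eigenvalue_root_char_poly[OF Q]
    by simp
  then obtain x where x: "x \<in> carrier_vec n" "x \<noteq> 0\<^sub>v n" "?Q *\<^sub>v x = 0 \<cdot>\<^sub>v x"
    using A unfolding eigenvalue_def eigenvector_def by auto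
  have sym': "A $$ (j, i) = A $$ (i, j)" if "i < n" "j < n" for i j
    using arg_cong[OF sym, of "\<lambda>M. M $$ (i, j)"] that A by simp
  have "(\<Sum>i<n. \<Sum>j<n. A $$ (i, j) * (x $ j)\<^sup>2) = (\<Sum>i<n. \<Sum>j<n. A $$ (i, j) * (x $ i)\<^sup>2)"
    by (subst sum.swap) (intro sum.cong refl, simp add: sym')
  moreover have "x \<bullet> (?Q *\<^sub>v x) = (\<Sum>i<n. \<Sum>j<n. A $$ (i, j) * (x $ i)\<^sup>2)
      + (\<Sum>i<n. \<Sum>j<n. A $$ (i, j) * (x $ i * x $ j))"
  proof -
    have "(mat_diag n r *\<^sub>v x) $ i = r i * x $ i" if "i < n" for i
      using that x(1)
      by (simp add: mat_diag_def scalar_prod_def if_distrib[of "\<lambda>c. c * _"] cong: if_cong)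
    then have "x \<bullet> (mat_diag n r *\<^sub>v x) = (\<Sum>i<n. r i * (x $ i)\<^sup>2)"
      using x(1) by (simp add: scalar_prod_def[of x] mat_diag_def atLeast0LessThan
          power2_eq_square ac_simps)
    moreover have "?Q *\<^sub>v x = mat_diag n r *\<^sub>v x + A *\<^sub>v x"
      using A x(1) by (intro add_mult_distrib_mat_vec[of _ n n]) auto
    moreover have "mat_diag n r *\<^sub>v x \<in> carrier_vec n" "A *\<^sub>v x \<in> carrier_vec n"
      using A x(1) by (auto intro!: mult_mat_vec_carrier[of _ n n])
    ultimately have "x \<bullet> (?Q *\<^sub>v x) = (\<Sum>i<n. r i * (x $ i)\<^sup>2) + x \<bullet> (A *\<^sub>v x)"
      using x(1) by (simp only: scalar_prod_add_distrib)
    then show ?thesis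
      by (simp only: scalar_prod_mult_mat_vec_eq_sum[OF A x(1) x(1)] r sum_distrib_right)
  qed
  moreover have "x \<bullet> (?Q *\<^sub>v x) = 0"
    unfolding x(3) using x(1) by simp
  moreover have "(\<Sum>i<n. \<Sum>j<n. A $$ (i, j) * (x $ i + x $ j)\<^sup>2)
      = (\<Sum>i<n. \<Sum>j<n. A $$ (i, j) * (x $ i)\<^sup>2) + (\<Sum>i<n. \<Sum>j<n. A $$ (i, j) * (x $ j)\<^sup>2)
        + 2 * (\<Sum>i<n. \<Sum>j<n. A $$ (i, j) * (x $ i * x $ j))"
    unfolding sum_distrib_left sum.distrib[symmetric]
    by (intro sum.cong refl) (simp add: power2_sum algebra_simps)
  ultimately have sum0: "(\<Sum>i<n. \<Sum>j<n. A $$ (i, j) * (x $ i + x $ j)\<^sup>2) = 0"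
    by linarith
  have zero: "A $$ (i, j) * (x $ i + x $ j)\<^sup>2 = 0" if "i < n" "j < n" for i j
    by (rule double_sum_nonneg_eq_0[OF sum0 _ that]) (simp add: nonneg)
  have "bipartite_mat A {i. 0 < x $ i}"
  proof (rule bipartite_mat_if_sign_pattern[OF A irr x(1,2)])
    fix i j assume ij: "i < n" "j < n" and nz: "A $$ (i, j) \<noteq> 0" "x $ j \<noteq> 0"
    have "x $ i = - x $ j"
      using zero[OF ij] nz by simp
    moreover have "0 < (x $ j)\<^sup>2"
      using nz by simp
    ultimately show "x $ i * x $ j < 0"
      by (simp add: power2_eq_square)
  qed
  then show ?thesis by blast
qed

text \<open>
  The spectral radius is the modulus of an eigenvalue; since that eigenvalue is real, it is \<open>\<rho>\<close> or
  \<open>-\<rho>\<close>, and in the former case symmetry of the spectrum gives the latter.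
\<close>

lemma uminus_spectral_radius_if_spectrum_symmetric:
  assumes A: "A \<in> carrier_mat n n" and n: "n > 0" and sym: "transpose_mat A = A"
    and "spectrum_symmetric (complex_mat A)"
  shows "- complex_of_real (spectral_radius (complex_mat A)) \<in> spectrum (complex_mat A)"
proof -
  let ?\<rho> = "spectral_radius (complex_mat A)"
  obtain l where l: "l \<in> spectrum (complex_mat A)" "?\<rho> = norm l"
    using spectral_radius_mem_max(1)[of "complex_mat A" n] A n by auto
  then have "l \<in> \<real>"
    using symmetric_mat_eigenvalue_real[OF A sym] by (simp add: spectrum_def)
  then obtain t where "l = complex_of_real t"
    by (elim Reals_cases)
  then have "- complex_of_real ?\<rho> = l \<or> - complex_of_real ?\<rho> = - l"
    using l(2) by (auto simp: abs_if)
  then show ?thesis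
    using assms(4) l(1) by (auto simp: spectrum_symmetric_def)
qed

section \<open>The equivalence for nonnegative symmetric irreducible matrices\<close>

theorem bipartite_mat_tfae:
  fixes A :: "real mat"
  defines "r \<equiv> \<lambda>i. \<Sum>j<dim_row A. A $$ (i, j)"
  assumes A: "A \<in> carrier_mat n n" and n: "n > 0" and sym: "transpose_mat A = A"
    and nonneg: "\<And>i j. i < n \<Longrightarrow> j < n \<Longrightarrow> 0 \<le> A $$ (i, j)"
    and irr: "irreducible_mat A"
  shows "(\<exists>S. bipartite_mat A S) \<longleftrightarrow> spectrum_symmetric (complex_mat A)" (is "?bip \<longleftrightarrow> ?sym")
    and "spectrum_symmetric (complex_mat A) \<longleftrightarrow>
      - complex_of_real (spectral_radius (complex_mat A)) \<in> spectrum (complex_mat A)"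
      (is "_ \<longleftrightarrow> ?ev")
    and "- complex_of_real (spectral_radius (complex_mat A)) \<in> spectrum (complex_mat A) \<longleftrightarrow>
      similar_mat (mat_diag n r - A) (mat_diag n r + A)" (is "_ \<longleftrightarrow> ?sim")
proof -
  have bip_sym: "?sym" if bip: ?bip
  proof -
    obtain S where "bipartite_mat A S" using bip by blast
    then have "bipartite_mat (complex_mat A) S"
      by (simp add: bipartite_mat_def)
    then have "similar_mat (mat_diag n (\<lambda>_. 0) - complex_mat A) (mat_diag n (\<lambda>_. 0) + complex_mat A)"
      using A by (intro bipartite_mat_similar) auto
    moreover have "mat_diag n (\<lambda>_. 0) - complex_mat A = - complex_mat A"
      and "mat_diag n (\<lambda>_. 0) + complex_mat A = complex_mat A"
      using A by (auto simp: mat_diag_def intro!: eq_matI)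
    ultimately have "similar_mat (- complex_mat A) (complex_mat A)"
      by (simp only:)
    then show ?thesis
      using A by (intro spectrum_symmetric_if_similar_uminus[of _ n]) auto
  qed
  have sym_ev: "?ev" if ?sym
    by (rule uminus_spectral_radius_if_spectrum_symmetric[OF A n sym that])
  have ev_bip: "?bip" if ?ev
    by (rule bipartite_mat_if_uminus_spectral_radius[OF A n sym nonneg irr that])
  have bip_sim: "?sim" if ?bip
    using that bipartite_mat_similar[OF A] by blast
  have sim_bip: "?bip" if ?sim
    using bipartite_mat_if_laplacians_similar[OF A n sym nonneg irr] that unfolding r_def by blast
  show "?bip \<longleftrightarrow> ?sym" "?sym \<longleftrightarrow> ?ev" "?ev \<longleftrightarrow> ?sim"
    using bip_sym sym_ev ev_bip bip_sim sim_bip by blast+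
qed

section \<open>Eccentricity matrices\<close>

definition ecc_entry :: "'a pair_pre_digraph \<Rightarrow> 'a \<Rightarrow> 'a \<Rightarrow> real" where
  "ecc_entry G u v = (if graph_dist G u v = min (eccentricity G u) (eccentricity G v)
     then real (graph_dist G u v) else 0)"

lemma ecc_mat_index:
  "i < length vs \<Longrightarrow> j < length vs \<Longrightarrow> ecc_mat G vs $$ (i, j) = ecc_entry G (vs ! i) (vs ! j)"
  by (simp add: ecc_mat_def ecc_entry_def)

lemma ecc_mat_carrier: "ecc_mat G vs \<in> carrier_mat (length vs) (length vs)"
  by (simp add: ecc_mat_def)

text \<open>Reversing a path is a length-preserving bijection, so the distance is symmetric.\<close>

lemma ecc_entry_commute:
  assumes "pair_graph G"
  shows "ecc_entry G u v = ecc_entry G v u"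
proof -
  interpret pair_graph G by fact
  have len: "length (rev_path p) = length p" for p :: "('a \<times> 'a) list"
    by (induction p) auto
  have imp: "\<exists>q. apath v q u \<and> length q = k" if "apath u p v" "length p = k" for u v p k
    using that by (intro exI[of _ "rev_path p"]) (simp add: len)
  have "(\<exists>p. apath u p v \<and> length p = k) \<longleftrightarrow> (\<exists>p. apath v p u \<and> length p = k)" for k
    using imp by blast
  then have "graph_dist G u v = graph_dist G v u"
    by (simp add: graph_dist_def)
  then show ?thesis
    by (simp add: ecc_entry_def min.commute)
qed

text \<open>
  The block form quantifies over labelings.  A partition of the vertices does not depend on a
  labeling, so it serves to pass from the labeling in the definition to the given one.  Conversely,
  listing one class before the other produces the blocks.
\<close>

lemma ecc_bipartite_iff_vertex_classes:
  assumes G: "pair_graph G" and vs: "vertex_labeling G vs"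
  shows "ecc_bipartite G \<longleftrightarrow>
    (\<exists>T. \<forall>u \<in> pverts G. \<forall>v \<in> pverts G. (u \<in> T \<longleftrightarrow> v \<in> T) \<longrightarrow> ecc_entry G u v = 0)"
proof
  assume "ecc_bipartite G"
  then obtain ws k B where ws: "vertex_labeling G ws" and k: "k \<le> length ws"
    and B: "B \<in> carrier_mat k (length ws - k)"
    and eq: "ecc_mat G ws
      = four_block_mat (0\<^sub>m k k) B (transpose_mat B) (0\<^sub>m (length ws - k) (length ws - k))"
    unfolding ecc_bipartite_def by (elim exE conjE)
  have "ecc_entry G u v = 0"
    if u: "u \<in> pverts G" and v: "v \<in> pverts G" and iff: "u \<in> set (take k ws) \<longleftrightarrow> v \<in> set (take k ws)" for u v
  proof -
    obtain i j where i: "i < length ws" "u = ws ! i" and j: "j < length ws" "v = ws ! j"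
      using u v ws unfolding vertex_labeling_def by (metis in_set_conv_nth)
    have mem: "ws ! l \<in> set (take k ws) \<longleftrightarrow> l < k" if "l < length ws" for l
      using that k ws unfolding vertex_labeling_def
      by (auto simp: in_set_conv_nth nth_eq_iff_index_eq)
    have "i < k \<longleftrightarrow> j < k"
      using iff mem i j by simp
    then have "ecc_mat G ws $$ (i, j) = 0"
      unfolding eq using i(1) j(1) k B by (auto simp: four_block_mat_def Let_def)
    then show ?thesis
      using i j by (simp add: ecc_mat_index)
  qed
  then show "\<exists>T. \<forall>u \<in> pverts G. \<forall>v \<in> pverts G. (u \<in> T \<longleftrightarrow> v \<in> T) \<longrightarrow> ecc_entry G u v = 0"
    by blast
next
  assume "\<exists>T. \<forall>u \<in> pverts G. \<forall>v \<in> pverts G. (u \<in> T \<longleftrightarrow> v \<in> T) \<longrightarrow> ecc_entry G u v = 0"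
  then obtain T
    where T: "\<forall>u \<in> pverts G. \<forall>v \<in> pverts G. (u \<in> T \<longleftrightarrow> v \<in> T) \<longrightarrow> ecc_entry G u v = 0"
    by (elim exE)
  define as bs where "as = filter (\<lambda>v. v \<in> T) vs" and "bs = filter (\<lambda>v. v \<notin> T) vs"
  define k where "k = length as"
  have ws: "vertex_labeling G (as @ bs)"
    using vs unfolding vertex_labeling_def as_def bs_def by auto
  have as: "as ! i \<in> T" "as ! i \<in> pverts G" if "i < length as" for i
    using nth_mem[OF that] vs unfolding vertex_labeling_def as_def by auto
  have bs: "bs ! i \<notin> T" "bs ! i \<in> pverts G" if "i < length bs" for i
    using nth_mem[OF that] vs unfolding vertex_labeling_def bs_def by auto
  let ?B = "mat k (length bs) (\<lambda>(i, j). ecc_entry G (as ! i) (bs ! j))"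
  have "ecc_mat G (as @ bs)
      = four_block_mat (0\<^sub>m k k) ?B (transpose_mat ?B) (0\<^sub>m (length bs) (length bs))"
  proof (intro eq_matI)
    fix i j
    assume "i < dim_row (four_block_mat (0\<^sub>m k k) ?B (transpose_mat ?B) (0\<^sub>m (length bs) (length bs)))"
      and "j < dim_col (four_block_mat (0\<^sub>m k k) ?B (transpose_mat ?B) (0\<^sub>m (length bs) (length bs)))"
    then have ij: "i < k + length bs" "j < k + length bs"
      by (auto simp: four_block_mat_def Let_def)
    consider "i < k" "j < k" | "i < k" "\<not> j < k" | "\<not> i < k" "j < k" | "\<not> i < k" "\<not> j < k"
      by linarith
    then have "ecc_entry G ((as @ bs) ! i) ((as @ bs) ! j)
      = four_block_mat (0\<^sub>m k k) ?B (transpose_mat ?B) (0\<^sub>m (length bs) (length bs)) $$ (i, j)"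
    proof cases
      case 1
      then show ?thesis
        using T as[of i] as[of j] by (simp add: nth_append k_def)
    next
      case 2
      then show ?thesis
        using ij by (simp add: nth_append k_def)
    next
      case 3
      then show ?thesis
        using ij ecc_entry_commute[OF G, of "bs ! (i - k)" "as ! j"] by (simp add: nth_append k_def)
    next
      case 4
      then show ?thesis
        using T ij bs[of "i - k"] bs[of "j - k"] by (simp add: nth_append k_def)
    qed
    then show "ecc_mat G (as @ bs) $$ (i, j)
      = four_block_mat (0\<^sub>m k k) ?B (transpose_mat ?B) (0\<^sub>m (length bs) (length bs)) $$ (i, j)"
      using ij by (simp add: ecc_mat_index k_def)
  qed (auto simp: ecc_mat_def four_block_mat_def Let_def k_def)
  then show "ecc_bipartite G"
    unfolding ecc_bipartite_def using ws
    by (intro exI[of _ "as @ bs"] exI[of _ k] exI[of _ ?B]) (simp add: k_def)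
qed

lemma ecc_bipartite_iff_bipartite_mat:
  assumes G: "pair_graph G" and vs: "vertex_labeling G vs"
  shows "ecc_bipartite G \<longleftrightarrow> (\<exists>S. bipartite_mat (ecc_mat G vs) S)"
  unfolding ecc_bipartite_iff_vertex_classes[OF assms]
proof
  assume "\<exists>T. \<forall>u \<in> pverts G. \<forall>v \<in> pverts G. (u \<in> T \<longleftrightarrow> v \<in> T) \<longrightarrow> ecc_entry G u v = 0"
  then obtain T
    where T: "\<forall>u \<in> pverts G. \<forall>v \<in> pverts G. (u \<in> T \<longleftrightarrow> v \<in> T) \<longrightarrow> ecc_entry G u v = 0"
    by (elim exE)
  have "vs ! i \<in> pverts G" if "i < length vs" for i
    using nth_mem[OF that] vs by (simp add: vertex_labeling_def)
  then have "bipartite_mat (ecc_mat G vs) {i. vs ! i \<in> T}"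
    using T ecc_mat_carrier[of G vs] by (simp add: bipartite_mat_def ecc_mat_index)
  then show "\<exists>S. bipartite_mat (ecc_mat G vs) S" by blast
next
  assume "\<exists>S. bipartite_mat (ecc_mat G vs) S"
  then obtain S where S: "bipartite_mat (ecc_mat G vs) S"
    by (elim exE)
  define T where "T = (!) vs ` (S \<inter> {..<length vs})"
  have mem: "vs ! i \<in> T \<longleftrightarrow> i \<in> S" if "i < length vs" for i
    using that vs by (auto simp: T_def vertex_labeling_def nth_eq_iff_index_eq)
  have "ecc_entry G u v = 0"
    if u: "u \<in> pverts G" and v: "v \<in> pverts G" and iff: "u \<in> T \<longleftrightarrow> v \<in> T" for u v
  proof -
    obtain i j where i: "i < length vs" "u = vs ! i" and j: "j < length vs" "v = vs ! j"
      using u v vs unfolding vertex_labeling_def by (metis in_set_conv_nth)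
    have "i \<in> S \<longleftrightarrow> j \<in> S"
      using iff mem[OF i(1)] mem[OF j(1)] i(2) j(2) by simp
    then have "ecc_mat G vs $$ (i, j) = 0"
      using S i(1) j(1) ecc_mat_carrier[of G vs] by (simp add: bipartite_mat_def)
    then show ?thesis
      using i j by (simp add: ecc_mat_index)
  qed
  then show "\<exists>T. \<forall>u \<in> pverts G. \<forall>v \<in> pverts G. (u \<in> T \<longleftrightarrow> v \<in> T) \<longrightarrow> ecc_entry G u v = 0"
    by (intro exI[of _ T]) simp
qed

theorem theorem4p1:
  fixes G :: "'a pair_pre_digraph" and vs :: "'a list"
  assumes "pair_graph G"
    and "Digraph_Component.connected (with_proj G)"
    and "vertex_labeling G vs"
    and "irreducible_mat (ecc_mat G vs)"
  shows "(ecc_bipartite G \<longleftrightarrow> spectrum_symmetric (complex_mat (ecc_mat G vs)))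
    \<and> (spectrum_symmetric (complex_mat (ecc_mat G vs)) \<longleftrightarrow>
         - complex_of_real (spectral_radius (complex_mat (ecc_mat G vs)))
           \<in> spectrum (complex_mat (ecc_mat G vs)))
    \<and> (- complex_of_real (spectral_radius (complex_mat (ecc_mat G vs)))
           \<in> spectrum (complex_mat (ecc_mat G vs)) \<longleftrightarrow>
         similar_mat (ecc_laplacian G vs) (ecc_signless_laplacian G vs))"
proof -
  let ?A = "ecc_mat G vs" and ?n = "length vs"
  have A: "?A \<in> carrier_mat ?n ?n"
    by (rule ecc_mat_carrier)
  have "pverts G \<noteq> {}"
    using assms(2) by (auto simp: connected_def strongly_connected_def)
  then have n: "?n > 0"
    using assms(3) by (auto simp: vertex_labeling_def)
  have sym: "transpose_mat ?A = ?A"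
    using A by (intro eq_matI) (auto simp: ecc_mat_index ecc_entry_commute[OF assms(1)])
  have nonneg: "0 \<le> ?A $$ (i, j)" if "i < ?n" "j < ?n" for i j
    using that by (simp add: ecc_mat_index ecc_entry_def)
  have "ecc_transmission G vs = (\<lambda>i. \<Sum>j<dim_row ?A. ?A $$ (i, j))"
    using A by (simp add: ecc_transmission_def fun_eq_iff)
  then show ?thesis
    using bipartite_mat_tfae[OF A n sym nonneg assms(4)]
      ecc_bipartite_iff_bipartite_mat[OF assms(1,3)]
    unfolding ecc_laplacian_def ecc_signless_laplacian_def by simp
qed

end
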